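(* Let $\bar p=p_1,\dots,p_m$. If $\phi(\bar p,\bar r)\to\psi(\bar p,\bar s)$ is a classical tautology, then (1) $\mathsf{IPC}\vdash\bigwedge_i(p_i\vee\neg p_i)\to(\neg\phi(\bar p,\bar r)\vee\neg\neg\psi(\bar p,\bar s))$, and (2) $\mathsf{K}\vdash\bigwedge_i(\Box p_i\vee\Box\neg p_i)\to(\Box\neg\phi(\bar p,\bar r)\vee\Box\psi(\bar p,\bar s))$. If moreover either $\phi(\bar p,\bar r)$ or $\psi(\bar p,\bar s)$ is monotone in $\bar p$, then, for a tuple $\bar q=q_1,\dots,q_m$ of fresh atoms, (3) $\mathsf{IPC}\vdash\bigwedge_i(p_i\vee q_i)\to(\neg\phi(\neg\bar p,\bar r)\vee\neg\neg\psi(\bar q,\bar s))$, and (4) $\mathsf{K}\vdash\bigwedge_i(\Box p_i\vee\Box q_i)\to(\Box\neg\phi(\neg\bar p,\bar r)\vee\Box\psi(\bar q,\bar s))$.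
   Context: Formulas are over $\{\top,\bot,\wedge,\vee,\to\}$ with $\neg\chi:=\chi\to\bot$. A formula is monotone in a set of atoms $P$ if no $\neg p$ with $p\in P$ occurs in its classical negation normal form. $\phi(\neg\bar p,\bar r)$ denotes the result of substituting $\neg p_i$ for $p_i$. $\mathsf{K}$ is the minimal normal modal logic. *)

theory Defs
  imports Main
begin

datatype (atoms: 'a) fm =
    Atom 'a
  | Top
  | Bot
  | And "'a fm" "'a fm"
  | Or "'a fm" "'a fm"
  | Imp "'a fm" "'a fm"

abbreviation Neg :: "'a fm \<Rightarrow> 'a fm" where
  "Neg \<chi> \<equiv> Imp \<chi> Bot"

definition Conj :: "'a fm list \<Rightarrow> 'a fm" where
  "Conj \<chi>s = foldr And \<chi>s Top"

primrec subst :: "('a \<Rightarrow> 'b fm) \<Rightarrow> 'a fm \<Rightarrow> 'b fm" where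
  "subst \<sigma> (Atom a) = \<sigma> a"
| "subst \<sigma> Top = Top"
| "subst \<sigma> Bot = Bot"
| "subst \<sigma> (And \<phi> \<psi>) = And (subst \<sigma> \<phi>) (subst \<sigma> \<psi>)"
| "subst \<sigma> (Or \<phi> \<psi>) = Or (subst \<sigma> \<phi>) (subst \<sigma> \<psi>)"
| "subst \<sigma> (Imp \<phi> \<psi>) = Imp (subst \<sigma> \<phi>) (subst \<sigma> \<psi>)"

text \<open>Simultaneous substitution of the i-th formula of a tuple for the i-th atom of a tuple;
  all other atoms are left unchanged.\<close>

definition subst_tuple :: "'a list \<Rightarrow> 'a fm list \<Rightarrow> 'a fm \<Rightarrow> 'a fm" where
  "subst_tuple ps \<chi>s =
     subst (\<lambda>a. case map_of (zip ps \<chi>s) a of None \<Rightarrow> Atom a | Some \<chi> \<Rightarrow> \<chi>)"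

primrec holds :: "('a \<Rightarrow> bool) \<Rightarrow> 'a fm \<Rightarrow> bool" where
  "holds v (Atom a) \<longleftrightarrow> v a"
| "holds v Top \<longleftrightarrow> True"
| "holds v Bot \<longleftrightarrow> False"
| "holds v (And \<phi> \<psi>) \<longleftrightarrow> holds v \<phi> \<and> holds v \<psi>"
| "holds v (Or \<phi> \<psi>) \<longleftrightarrow> holds v \<phi> \<or> holds v \<psi>"
| "holds v (Imp \<phi> \<psi>) \<longleftrightarrow> (holds v \<phi> \<longrightarrow> holds v \<psi>)"

definition tautology :: "'a fm \<Rightarrow> bool" where
  "tautology \<phi> \<longleftrightarrow> (\<forall>v. holds v \<phi>)"

text \<open>Classical negation normal form of a formula and of its negation. The result is again a
  formula, in which \<open>Imp\<close> occurs only in literals \<open>Neg (Atom a)\<close>.\<close>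

fun nnf :: "'a fm \<Rightarrow> 'a fm" and nnf_neg :: "'a fm \<Rightarrow> 'a fm" where
  "nnf (Atom a) = Atom a"
| "nnf Top = Top"
| "nnf Bot = Bot"
| "nnf (And \<phi> \<psi>) = And (nnf \<phi>) (nnf \<psi>)"
| "nnf (Or \<phi> \<psi>) = Or (nnf \<phi>) (nnf \<psi>)"
| "nnf (Imp \<phi> \<psi>) = Or (nnf_neg \<phi>) (nnf \<psi>)"
| "nnf_neg (Atom a) = Neg (Atom a)"
| "nnf_neg Top = Bot"
| "nnf_neg Bot = Top"
| "nnf_neg (And \<phi> \<psi>) = Or (nnf_neg \<phi>) (nnf_neg \<psi>)"
| "nnf_neg (Or \<phi> \<psi>) = And (nnf_neg \<phi>) (nnf_neg \<psi>)"
| "nnf_neg (Imp \<phi> \<psi>) = And (nnf \<phi>) (nnf_neg \<psi>)"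

primrec subformulas :: "'a fm \<Rightarrow> 'a fm set" where
  "subformulas (Atom a) = {Atom a}"
| "subformulas Top = {Top}"
| "subformulas Bot = {Bot}"
| "subformulas (And \<phi> \<psi>) = insert (And \<phi> \<psi>) (subformulas \<phi> \<union> subformulas \<psi>)"
| "subformulas (Or \<phi> \<psi>) = insert (Or \<phi> \<psi>) (subformulas \<phi> \<union> subformulas \<psi>)"
| "subformulas (Imp \<phi> \<psi>) = insert (Imp \<phi> \<psi>) (subformulas \<phi> \<union> subformulas \<psi>)"

definition monotone_in :: "'a set \<Rightarrow> 'a fm \<Rightarrow> bool" where
  "monotone_in P \<phi> \<longleftrightarrow> (\<forall>p\<in>P. Neg (Atom p) \<notin> subformulas (nnf \<phi>))"

inductive IPC_deriv :: "'a fm set \<Rightarrow> 'a fm \<Rightarrow> bool" where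
  Assm: "\<phi> \<in> \<Gamma> \<Longrightarrow> IPC_deriv \<Gamma> \<phi>"
| TopI: "IPC_deriv \<Gamma> Top"
| BotE: "IPC_deriv \<Gamma> Bot \<Longrightarrow> IPC_deriv \<Gamma> \<phi>"
| AndI: "IPC_deriv \<Gamma> \<phi> \<Longrightarrow> IPC_deriv \<Gamma> \<psi> \<Longrightarrow> IPC_deriv \<Gamma> (And \<phi> \<psi>)"
| AndE1: "IPC_deriv \<Gamma> (And \<phi> \<psi>) \<Longrightarrow> IPC_deriv \<Gamma> \<phi>"
| AndE2: "IPC_deriv \<Gamma> (And \<phi> \<psi>) \<Longrightarrow> IPC_deriv \<Gamma> \<psi>"
| OrI1: "IPC_deriv \<Gamma> \<phi> \<Longrightarrow> IPC_deriv \<Gamma> (Or \<phi> \<psi>)"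
| OrI2: "IPC_deriv \<Gamma> \<psi> \<Longrightarrow> IPC_deriv \<Gamma> (Or \<phi> \<psi>)"
| OrE: "IPC_deriv \<Gamma> (Or \<phi> \<psi>) \<Longrightarrow> IPC_deriv (insert \<phi> \<Gamma>) \<chi> \<Longrightarrow>
    IPC_deriv (insert \<psi> \<Gamma>) \<chi> \<Longrightarrow> IPC_deriv \<Gamma> \<chi>"
| ImpI: "IPC_deriv (insert \<phi> \<Gamma>) \<psi> \<Longrightarrow> IPC_deriv \<Gamma> (Imp \<phi> \<psi>)"
| ImpE: "IPC_deriv \<Gamma> (Imp \<phi> \<psi>) \<Longrightarrow> IPC_deriv \<Gamma> \<phi> \<Longrightarrow> IPC_deriv \<Gamma> \<psi>"

definition IPC_provable :: "'a fm \<Rightarrow> bool" where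
  "IPC_provable \<phi> \<longleftrightarrow> IPC_deriv {} \<phi>"

datatype 'a mfm =
    MAtom 'a
  | MTop
  | MBot
  | MAnd "'a mfm" "'a mfm"
  | MOr "'a mfm" "'a mfm"
  | MImp "'a mfm" "'a mfm"
  | Box "'a mfm"

abbreviation MNeg :: "'a mfm \<Rightarrow> 'a mfm" where
  "MNeg \<chi> \<equiv> MImp \<chi> MBot"

definition MConj :: "'a mfm list \<Rightarrow> 'a mfm" where
  "MConj \<chi>s = foldr MAnd \<chi>s MTop"

primrec msubst :: "('a \<Rightarrow> 'b mfm) \<Rightarrow> 'a fm \<Rightarrow> 'b mfm" where
  "msubst \<sigma> (Atom a) = \<sigma> a"
| "msubst \<sigma> Top = MTop"
| "msubst \<sigma> Bot = MBot"
| "msubst \<sigma> (And \<phi> \<psi>) = MAnd (msubst \<sigma> \<phi>) (msubst \<sigma> \<psi>)"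
| "msubst \<sigma> (Or \<phi> \<psi>) = MOr (msubst \<sigma> \<phi>) (msubst \<sigma> \<psi>)"
| "msubst \<sigma> (Imp \<phi> \<psi>) = MImp (msubst \<sigma> \<phi>) (msubst \<sigma> \<psi>)"

abbreviation modal :: "'a fm \<Rightarrow> 'a mfm" where
  "modal \<equiv> msubst MAtom"

text \<open>The tautologies being instantiated are taken over countably
  many atoms, so that all instances are available whatever the size of the type \<open>'a\<close>.\<close>

inductive K_provable :: "'a mfm \<Rightarrow> bool" where
  Taut: "tautology (\<chi> :: nat fm) \<Longrightarrow> K_provable (msubst \<sigma> \<chi>)"
| K: "K_provable (MImp (Box (MImp \<phi> \<psi>)) (MImp (Box \<phi>) (Box \<psi>)))"
| MP: "K_provable (MImp \<phi> \<psi>) \<Longrightarrow> K_provable \<phi> \<Longrightarrow> K_provable \<psi>"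
| Nec: "K_provable \<phi> \<Longrightarrow> K_provable (Box \<phi>)"

end

theory Submission
  imports Defs
begin

text \<open>Deciding each disjunction in the antecedent leaves a set of literals. For each such choice,
  either the literals classically refute the first formula or they classically imply the second:
  otherwise two countermodels, which agree on the common atoms (or are ordered on them, in the
  monotone case), can be merged into a countermodel of the tautology. Glivenko's theorem makes
  these classical consequences intuitionistic up to double negation; necessitation transfers them
  to boxed formulas in K.\<close>

section \<open>Classical semantics\<close>

lemma holds_cong: "(\<And>a. a \<in> atoms \<phi> \<Longrightarrow> v a = w a) \<Longrightarrow> holds v \<phi> = holds w \<phi>"
  by (induction \<phi>) auto

lemma holds_subst: "holds v (subst \<sigma> \<phi>) = holds (\<lambda>a. holds v (\<sigma> a)) \<phi>"
  by (induction \<phi>) auto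

lemma holds_map_fm: "holds v (map_fm f \<phi>) = holds (v \<circ> f) \<phi>"
  by (induction \<phi>) auto

lemma holds_Conj: "holds v (Conj \<chi>s) \<longleftrightarrow> (\<forall>\<chi>\<in>set \<chi>s. holds v \<chi>)"
  unfolding Conj_def by (induction \<chi>s) auto

lemma holds_Conj_map: "holds v (Conj (map h is)) \<longleftrightarrow> (\<forall>i\<in>set is. holds v (h i))"
  by (simp add: holds_Conj del: set_map) auto

lemma holds_nnf: "holds v (nnf \<phi>) = holds v \<phi>" "holds v (nnf_neg \<phi>) = (\<not> holds v \<phi>)"
  by (induction \<phi>) auto

text \<open>In a negation normal form without negative literals over \<open>P\<close>, raising the
  values on \<open>P\<close> preserves truth. \<open>nnf\<close> and \<open>nnf_neg\<close> call
  each other under implication, so both claims go through one induction. At an atom of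
  \<open>P\<close>, the claim for \<open>nnf_neg\<close> is vacuous, since the forbidden literal is
  the whole formula.\<close>

lemma holds_nnf_mono:
  assumes "\<And>a. a \<in> P \<Longrightarrow> v a \<Longrightarrow> w a"
  shows "(\<And>a. a \<in> atoms \<phi> - P \<Longrightarrow> v a = w a) \<Longrightarrow>
      \<forall>p\<in>P. Neg (Atom p) \<notin> subformulas (nnf \<phi>) \<Longrightarrow> holds v (nnf \<phi>) \<Longrightarrow> holds w (nnf \<phi>)"
    and "(\<And>a. a \<in> atoms \<phi> - P \<Longrightarrow> v a = w a) \<Longrightarrow>
      \<forall>p\<in>P. Neg (Atom p) \<notin> subformulas (nnf_neg \<phi>) \<Longrightarrow>
      holds v (nnf_neg \<phi>) \<Longrightarrow> holds w (nnf_neg \<phi>)"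
proof (induction \<phi>)
  case (Atom a)
  { case 1 then show ?case using assms by (cases "a \<in> P") auto }
  { case 2 then show ?case by (cases "a \<in> P") auto }
qed auto

lemma holds_mono:
  assumes "monotone_in P \<phi>" and "\<And>a. a \<in> P \<Longrightarrow> v a \<Longrightarrow> w a"
    and "\<And>a. a \<in> atoms \<phi> - P \<Longrightarrow> v a = w a" and "holds v \<phi>"
  shows "holds w \<phi>"
  using holds_nnf_mono(1)[of P v w \<phi>] assms by (auto simp: holds_nnf monotone_in_def)

text \<open>A weak interpolation argument: \<phi> and \<psi> only interact through shared atoms, so
  \<open>v\<close> and \<open>w\<close> merge into one valuation to which the tautology applies.
  With \<open>P\<close> empty, monotonicity is vacuous and the valuations must agree on all shared
  atoms.\<close>

lemma tautology_Imp_transfer: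
  assumes taut: "tautology (Imp \<phi> \<psi>)"
    and mono: "monotone_in P \<phi> \<or> monotone_in P \<psi>"
    and le: "\<And>a. a \<in> P \<Longrightarrow> v a \<Longrightarrow> w a"
    and eq: "\<And>a. a \<in> atoms \<phi> \<inter> atoms \<psi> - P \<Longrightarrow> v a = w a"
    and "holds v \<phi>"
  shows "holds w \<psi>"
  using mono
proof
  assume m: "monotone_in P \<phi>"
  \<comment> \<open>\<psi> cannot tell \<open>u\<close> from \<open>w\<close>, while on \<phi> the
    passage from \<open>v\<close> to \<open>u\<close> only raises atoms of \<open>P\<close>.\<close>
  define u where "u a = (if a \<in> P \<union> atoms \<psi> then w a else v a)" for a
  have "holds u \<phi>"
    by (rule holds_mono[OF m _ _ \<open>holds v \<phi>\<close>]) (use le eq in \<open>auto simp: u_def\<close>)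
  then have "holds u \<psi>" using taut by (auto simp: tautology_def)
  then show ?thesis using holds_cong[of \<psi> u w] by (auto simp: u_def)
next
  assume m: "monotone_in P \<psi>"
  \<comment> \<open>The mirror image: \<phi> cannot tell \<open>u\<close> from \<open>v\<close>, and
    monotonicity carries \<psi> from \<open>u\<close> up to \<open>w\<close>.\<close>
  define u where "u a = (if a \<in> P \<union> atoms \<phi> then v a else w a)" for a
  have "holds u \<phi>" using \<open>holds v \<phi>\<close> holds_cong[of \<phi> u v] by (auto simp: u_def)
  then have "holds u \<psi>" using taut by (auto simp: tautology_def)
  then show ?thesis
    by (rule holds_mono[OF m, rotated -1]) (use le eq in \<open>auto simp: u_def\<close>)
qed

section \<open>Glivenko's theorem\<close>

lemma IPC_weaken: "IPC_deriv \<Gamma> \<phi> \<Longrightarrow> \<Gamma> \<subseteq> \<Delta> \<Longrightarrow> IPC_deriv \<Delta> \<phi>"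
proof (induction arbitrary: \<Delta> rule: IPC_deriv.induct)
  case (OrE \<Gamma> \<phi> \<psi> \<chi>)
  show ?case
    by (rule IPC_deriv.OrE[OF OrE.IH(1) OrE.IH(2) OrE.IH(3)]) (use OrE.prems in auto)
next
  case (ImpI \<phi> \<Gamma> \<psi>)
  show ?case by (rule IPC_deriv.ImpI) (use ImpI.prems in \<open>auto intro!: ImpI.IH\<close>)
qed (auto intro: IPC_deriv.intros)

lemma IPC_insert: "IPC_deriv \<Gamma> \<phi> \<Longrightarrow> IPC_deriv (insert \<psi> \<Gamma>) \<phi>"
  by (rule IPC_weaken) auto

lemma IPC_hyp: "IPC_deriv (insert \<phi> \<Gamma>) \<phi>"
  by (rule Assm) simp

lemma IPC_cut: "IPC_deriv (insert \<phi> \<Gamma>) \<psi> \<Longrightarrow> IPC_deriv \<Gamma> \<phi> \<Longrightarrow> IPC_deriv \<Gamma> \<psi>"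
  by (rule ImpE[OF ImpI])

definition literals :: "('a \<Rightarrow> bool) \<Rightarrow> 'a set \<Rightarrow> 'a fm set" where
  "literals v A = (\<lambda>a. if v a then Atom a else Neg (Atom a)) ` A"

text \<open>Kalmar's lemma: once every atom is decided by a hypothesis, each connective passes
  decisions upwards by intuitionistic rules alone.\<close>

lemma literals_decide:
  assumes "atoms \<chi> \<subseteq> A"
  shows "IPC_deriv (literals v A) (if holds v \<chi> then \<chi> else Neg \<chi>)"
  using assms
proof (induction \<chi>)
  case (Atom a)
  then show ?case by (auto simp: literals_def intro!: Assm)
next
  case Top
  show ?case by (simp add: TopI)
next
  case Bot
  show ?case by (simp add: ImpI IPC_hyp)
next
  case (And \<phi> \<psi>)
  have "IPC_deriv \<Gamma> (Neg (And \<phi> \<psi>))" if "IPC_deriv \<Gamma> (Neg \<phi>)" for \<Gamma>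
    by (rule ImpI, rule ImpE[OF IPC_insert[OF that]], rule AndE1, rule IPC_hyp)
  moreover have "IPC_deriv \<Gamma> (Neg (And \<phi> \<psi>))" if "IPC_deriv \<Gamma> (Neg \<psi>)" for \<Gamma>
    by (rule ImpI, rule ImpE[OF IPC_insert[OF that]], rule AndE2, rule IPC_hyp)
  ultimately show ?case using And by (auto intro: AndI split: if_splits)
next
  case (Or \<phi> \<psi>)
  have "IPC_deriv \<Gamma> (Neg (Or \<phi> \<psi>))"
    if "IPC_deriv \<Gamma> (Neg \<phi>)" "IPC_deriv \<Gamma> (Neg \<psi>)" for \<Gamma>
    by (rule ImpI, rule OrE[OF IPC_hyp];
        rule ImpE[OF IPC_insert[OF IPC_insert] IPC_hyp], rule that)
  then show ?case using Or by (auto intro: OrI1 OrI2 split: if_splits)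
next
  case (Imp \<phi> \<psi>)
  have "IPC_deriv \<Gamma> (Imp \<phi> \<psi>)" if "IPC_deriv \<Gamma> (Neg \<phi>)" for \<Gamma>
    by (rule ImpI, rule BotE, rule ImpE[OF IPC_insert[OF that] IPC_hyp])
  moreover have "IPC_deriv \<Gamma> (Imp \<phi> \<psi>)" if "IPC_deriv \<Gamma> \<psi>" for \<Gamma>
    by (rule ImpI, rule IPC_insert, rule that)
  moreover have "IPC_deriv \<Gamma> (Neg (Imp \<phi> \<psi>))"
    if "IPC_deriv \<Gamma> \<phi>" "IPC_deriv \<Gamma> (Neg \<psi>)" for \<Gamma>
    by (rule ImpI, rule ImpE[OF IPC_insert[OF that(2)] ImpE[OF IPC_hyp IPC_insert[OF that(1)]]])
  ultimately show ?case using Imp by (auto split: if_splits)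
qed

text \<open>Excluded middle is admissible when the goal is \<open>Bot\<close>: refuting
  \<open>Atom a\<close> proves its negation, which is then cut against the other case. \<Gamma>
  varies in the induction because it collects the literal of the atom being removed.\<close>

lemma IPC_literals_elim:
  assumes "finite A" and "\<And>v. IPC_deriv (literals v A \<union> \<Gamma>) Bot"
  shows "IPC_deriv \<Gamma> Bot"
  using assms
proof (induction A arbitrary: \<Gamma> rule: finite_induct)
  case empty
  then show ?case by (simp add: literals_def)
next
  case (insert a A)
  \<comment> \<open>Updating at \<open>a\<close>, which is not in \<open>A\<close>, fixes the
    literal of \<open>a\<close> and leaves \<open>v\<close> free on \<open>A\<close>.\<close>
  have *: "literals (v(a := b)) (insert a A) \<union> \<Gamma> =
      literals v A \<union> insert (if b then Atom a else Neg (Atom a)) \<Gamma>" for v b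
    using insert.hyps by (auto simp: literals_def)
  have "IPC_deriv (insert (if b then Atom a else Neg (Atom a)) \<Gamma>) Bot" for b
    using insert.prems[of "_(a := b)"] unfolding * by (rule insert.IH)
  from this[of True] this[of False]
  have "IPC_deriv (insert (Atom a) \<Gamma>) Bot" "IPC_deriv (insert (Neg (Atom a)) \<Gamma>) Bot"
    by simp_all
  then show ?case by (rule IPC_cut[OF _ ImpI, rotated])
qed

text \<open>Glivenko's theorem in refutation form. Over all atoms of \<Gamma>, the literals of any
  valuation refute the member of \<Gamma> that it falsifies; the literals are then eliminated
  because the goal is \<open>Bot\<close>.\<close>

lemma IPC_refutes_unsatisfiable:
  assumes "finite \<Gamma>" and "\<And>v. \<exists>\<gamma>\<in>\<Gamma>. \<not> holds v \<gamma>"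
  shows "IPC_deriv \<Gamma> Bot"
proof (rule IPC_literals_elim)
  show "finite (\<Union> (atoms ` \<Gamma>))"
    using \<open>finite \<Gamma>\<close> by (auto simp: fm.set_finite)
  fix v
  obtain \<gamma> where \<gamma>: "\<gamma> \<in> \<Gamma>" "\<not> holds v \<gamma>" using assms(2) by blast
  then have "IPC_deriv (literals v (\<Union> (atoms ` \<Gamma>))) (Neg \<gamma>)"
    using literals_decide[of \<gamma> "\<Union> (atoms ` \<Gamma>)" v] by auto
  then have "IPC_deriv (literals v (\<Union> (atoms ` \<Gamma>)) \<union> \<Gamma>) (Neg \<gamma>)"
    by (rule IPC_weaken) simp
  then show "IPC_deriv (literals v (\<Union> (atoms ` \<Gamma>)) \<union> \<Gamma>) Bot"
    by (rule ImpE) (use \<gamma> in \<open>auto intro: Assm\<close>)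
qed

lemma IPC_Imp_ConjI: "IPC_deriv (set \<chi>s \<union> \<Gamma>) \<phi> \<Longrightarrow> IPC_deriv \<Gamma> (Imp (Conj \<chi>s) \<phi>)"
proof (induction \<chi>s arbitrary: \<Gamma>)
  case Nil
  then show ?case by (simp add: ImpI IPC_insert)
next
  case (Cons \<chi> \<chi>s)
  let ?\<Delta> = "insert (Conj (\<chi> # \<chi>s)) \<Gamma>"
  have conj: "IPC_deriv ?\<Delta> (And \<chi> (Conj \<chi>s))"
    by (rule Assm) (simp add: Conj_def)
  have "IPC_deriv (insert \<chi> \<Gamma>) (Imp (Conj \<chi>s) \<phi>)"
    using Cons.prems by (intro Cons.IH) simp
  then have "IPC_deriv (insert \<chi> ?\<Delta>) (Imp (Conj \<chi>s) \<phi>)"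
    by (rule IPC_weaken) auto
  then have "IPC_deriv ?\<Delta> (Imp (Conj \<chi>s) \<phi>)"
    using AndE1[OF conj] by (rule IPC_cut)
  then show ?case using AndE2[OF conj] by (intro ImpI) (rule ImpE)
qed

text \<open>A conjunction of disjunctions is distributed into its choice functions \<open>c\<close>.
  The induction treats the head disjunct as a premise of \<delta>, which is why \<delta> is
  arbitrary.\<close>

lemma IPC_choice:
  assumes "distinct is"
    and "\<And>c. IPC_provable (Imp (Conj (map (\<lambda>i. if c i then f i else g i) is)) \<delta>)"
  shows "IPC_provable (Imp (Conj (map (\<lambda>i. Or (f i) (g i)) is)) \<delta>)"
  using assms
proof (induction "is" arbitrary: \<delta>)
  case Nil
  then show ?case by simp
next
  case (Cons i "is")
  let ?C = "Conj (map (\<lambda>i. Or (f i) (g i)) is)"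
  have "IPC_provable (Imp ?C (Imp (if b then f i else g i) \<delta>))" for b
  proof (rule Cons.IH)
    show "distinct is" using Cons.prems by simp
    fix c
    let ?D = "Conj (map (\<lambda>i. if c i then f i else g i) is)" and ?h = "if b then f i else g i"
    \<comment> \<open>By distinctness \<open>i\<close> does not recur in the tail, so the update
      changes only the head's choice.\<close>
    have *: "map (\<lambda>j. if (c(i := b)) j then f j else g j) (i # is) =
        ?h # map (\<lambda>i. if c i then f i else g i) is"
      using Cons.prems by auto
    have "IPC_deriv {} (Imp (And ?h ?D) \<delta>)"
      using Cons.prems(2)[of "c(i := b)"]
      unfolding * unfolding IPC_provable_def Conj_def foldr.simps o_apply .
    then have "IPC_deriv {?h, ?D} (Imp (And ?h ?D) \<delta>)"
      by (rule IPC_weaken) simp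
    then have "IPC_deriv {?h, ?D} \<delta>"
      by (rule ImpE) (intro AndI Assm; simp)
    then show "IPC_provable (Imp ?D (Imp ?h \<delta>))"
      unfolding IPC_provable_def by (intro ImpI)
  qed
  from this[of True] this[of False]
  have imps: "IPC_deriv {} (Imp ?C (Imp (f i) \<delta>))" "IPC_deriv {} (Imp ?C (Imp (g i) \<delta>))"
    by (simp_all add: IPC_provable_def)
  let ?A = "And (Or (f i) (g i)) ?C"
  have C: "IPC_deriv {?A} ?C" and or: "IPC_deriv {?A} (Or (f i) (g i))"
    by (rule AndE2, rule IPC_hyp) (rule AndE1, rule IPC_hyp)
  have "IPC_deriv {?A} \<delta>"
    by (rule OrE[OF or]; rule ImpE[OF _ IPC_hyp], rule IPC_insert, rule ImpE[OF _ C],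
        rule IPC_insert, rule imps)
  then show ?case
    by (simp add: IPC_provable_def Conj_def ImpI)
qed

section \<open>Derivations in the logic K\<close>

text \<open>A formula has finitely many atoms, so it can be renamed injectively into the naturals;
  the substitution then undoes the renaming.\<close>

lemma K_provable_tautology:
  assumes "tautology \<chi>"
  shows "K_provable (msubst \<sigma> \<chi>)"
proof -
  have "finite (atoms \<chi>)" by (rule fm.set_finite)
  then obtain f :: "_ \<Rightarrow> nat" where f: "inj_on f (atoms \<chi>)"
    using finite_imp_inj_to_nat_seg by blast
  have "tautology (map_fm f \<chi>)"
    using assms by (simp add: tautology_def holds_map_fm)
  then have "K_provable (msubst (\<sigma> \<circ> inv_into (atoms \<chi>) f) (map_fm f \<chi>))"
    by (rule Taut)
  \<comment> \<open>The inverse stays tied to the atoms of \<chi> while the induction runs over an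
    arbitrary \<theta> with atoms among them.\<close>
  moreover have "msubst (\<sigma> \<circ> inv_into (atoms \<chi>) f) (map_fm f \<theta>) = msubst \<sigma> \<theta>"
    if "atoms \<theta> \<subseteq> atoms \<chi>" for \<theta>
    using that f by (induction \<theta>) auto
  ultimately show ?thesis by simp
qed

text \<open>The propositional skeleton treats atoms and boxed formulas as atoms, so that propositional
  reasoning in K becomes a matter of truth values.\<close>

primrec skeleton :: "'a mfm \<Rightarrow> 'a mfm fm" where
  "skeleton (MAtom a) = Atom (MAtom a)"
| "skeleton MTop = Top"
| "skeleton MBot = Bot"
| "skeleton (MAnd \<phi> \<psi>) = And (skeleton \<phi>) (skeleton \<psi>)"
| "skeleton (MOr \<phi> \<psi>) = Or (skeleton \<phi>) (skeleton \<psi>)"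
| "skeleton (MImp \<phi> \<psi>) = Imp (skeleton \<phi>) (skeleton \<psi>)"
| "skeleton (Box \<phi>) = Atom (Box \<phi>)"

lemma msubst_skeleton: "msubst id (skeleton \<phi>) = \<phi>"
  by (induction \<phi>) auto

lemma K_provable_skeleton: "tautology (skeleton \<phi>) \<Longrightarrow> K_provable \<phi>"
  using K_provable_tautology[of "skeleton \<phi>" id] by (simp add: msubst_skeleton)

lemma K_provable_mono:
  assumes "K_provable \<phi>" and "\<And>v. holds v (skeleton \<phi>) \<Longrightarrow> holds v (skeleton \<psi>)"
  shows "K_provable \<psi>"
proof (rule MP)
  show "K_provable (MImp \<phi> \<psi>)"
    using assms(2) by (intro K_provable_skeleton) (simp add: tautology_def)
qed fact

lemma K_provable_mono2:
  assumes "K_provable \<phi>" "K_provable \<psi>"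
    and "\<And>v. holds v (skeleton \<phi>) \<Longrightarrow> holds v (skeleton \<psi>) \<Longrightarrow> holds v (skeleton \<chi>)"
  shows "K_provable \<chi>"
proof (rule MP)
  show "K_provable (MImp \<psi> \<chi>)"
    using assms(1) by (rule K_provable_mono) (use assms(3) in simp)
qed fact

text \<open>Premises are curried into the conclusion until a tautology remains, which is
  necessitated; axiom K then takes the boxed premises back out one at a time.\<close>

lemma K_Box_entailment:
  "tautology (Imp (Conj \<chi>s) \<phi>) \<Longrightarrow>
   K_provable (MImp (MConj (map (\<lambda>\<chi>. Box (modal \<chi>)) \<chi>s)) (Box (modal \<phi>)))"
proof (induction \<chi>s arbitrary: \<phi>)
  case Nil
  then have "K_provable (Box (modal \<phi>))"
    by (intro Nec K_provable_tautology) (simp add: tautology_def Conj_def)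
  then show ?case by (rule K_provable_mono) simp
next
  case (Cons \<chi> \<chi>s)
  have "tautology (Imp (Conj \<chi>s) (Imp \<chi> \<phi>))"
    using Cons.prems by (auto simp: tautology_def Conj_def)
  from K_provable_mono2[OF Cons.IH[OF this] K[of "modal \<chi>" "modal \<phi>"]]
  show ?case by (simp add: MConj_def)
qed

lemma K_choice:
  assumes "distinct is"
    and "\<And>c. K_provable (MImp (MConj (map (\<lambda>i. if c i then f i else g i) is)) \<delta>)"
  shows "K_provable (MImp (MConj (map (\<lambda>i. MOr (f i) (g i)) is)) \<delta>)"
  using assms
proof (induction "is" arbitrary: \<delta>)
  case Nil
  then show ?case by simp
next
  case (Cons i "is")
  let ?C = "MConj (map (\<lambda>i. MOr (f i) (g i)) is)"
  have "K_provable (MImp ?C (MImp (if b then f i else g i) \<delta>))" for b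
  proof (rule Cons.IH)
    show "distinct is" using Cons.prems by simp
    fix c
    let ?D = "MConj (map (\<lambda>i. if c i then f i else g i) is)" and ?h = "if b then f i else g i"
    have *: "map (\<lambda>j. if (c(i := b)) j then f j else g j) (i # is) =
        ?h # map (\<lambda>i. if c i then f i else g i) is"
      using Cons.prems by auto
    have "K_provable (MImp (MAnd ?h ?D) \<delta>)"
      using Cons.prems(2)[of "c(i := b)"] unfolding * unfolding MConj_def foldr.simps o_apply .
    then show "K_provable (MImp ?D (MImp ?h \<delta>))"
      by (rule K_provable_mono) auto
  qed
  from this[of True] this[of False] show ?case
    by (rule K_provable_mono2) (auto simp: MConj_def)
qed

section \<open>Provability by case distinction on the literals\<close>

text \<open>The common core of all four claims: \<open>f i\<close> and \<open>g i\<close> are the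
  two alternatives at index \<open>i\<close>. In \<open>sem\<close> the valuations \<open>v\<close>
  and \<open>w\<close> are independent and share only the choice \<open>c\<close>.\<close>

lemma provable_disjunction:
  assumes "distinct is"
    and sem: "\<And>c v w. holds v (Conj (map (\<lambda>i. if c i then f i else g i) is)) \<Longrightarrow>
      holds w (Conj (map (\<lambda>i. if c i then f i else g i) is)) \<Longrightarrow> holds v \<phi> \<Longrightarrow> holds w \<psi>"
  shows IPC_provable_disjunction: "IPC_provable
      (Imp (Conj (map (\<lambda>i. Or (f i) (g i)) is)) (Or (Neg \<phi>) (Neg (Neg \<psi>))))"
    and K_provable_disjunction: "K_provable
      (MImp (MConj (map (\<lambda>i. MOr (Box (modal (f i))) (Box (modal (g i)))) is))
        (MOr (Box (MNeg (modal \<phi>))) (Box (modal \<psi>))))"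
proof -
  let ?L = "\<lambda>c. map (\<lambda>i. if c i then f i else g i) is"
  \<comment> \<open>If one valuation satisfies the chosen formulas and \<phi>, then
    \<open>sem\<close> forces \<psi> in every valuation satisfying them. So each choice settles one
    disjunct outright.\<close>
  have sem': "(\<forall>v. holds v (Conj (?L c)) \<longrightarrow> \<not> holds v \<phi>) \<or>
      (\<forall>v. holds v (Conj (?L c)) \<longrightarrow> holds v \<psi>)" for c
    using sem[of _ c] by blast
  show "IPC_provable (Imp (Conj (map (\<lambda>i. Or (f i) (g i)) is)) (Or (Neg \<phi>) (Neg (Neg \<psi>))))"
  proof (rule IPC_choice[OF \<open>distinct is\<close>])
    fix c
    \<comment> \<open>Applied with \<chi> as \<phi> for the left disjunct and as
      \<open>Neg \<psi>\<close> for the right one, where it yields the double negation.\<close>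
    have neg: "IPC_deriv (set (?L c)) (Neg \<chi>)"
      if "\<forall>v. holds v (Conj (?L c)) \<longrightarrow> \<not> holds v \<chi>" for \<chi>
    proof (rule ImpI, rule IPC_refutes_unsatisfiable)
      show "\<exists>\<gamma>\<in>insert \<chi> (set (?L c)). \<not> holds v \<gamma>" for v
        using that unfolding holds_Conj by blast
    qed simp
    have "IPC_deriv (set (?L c)) (Or (Neg \<phi>) (Neg (Neg \<psi>)))"
      using sem'[of c]
    proof
      assume "\<forall>v. holds v (Conj (?L c)) \<longrightarrow> \<not> holds v \<phi>"
      then show ?thesis by (intro OrI1 neg)
    next
      assume "\<forall>v. holds v (Conj (?L c)) \<longrightarrow> holds v \<psi>"
      then show ?thesis by (intro OrI2 neg) simp
    qed
    then show "IPC_provable (Imp (Conj (?L c)) (Or (Neg \<phi>) (Neg (Neg \<psi>))))"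
      unfolding IPC_provable_def by (intro IPC_Imp_ConjI) simp
  qed
  show "K_provable (MImp (MConj (map (\<lambda>i. MOr (Box (modal (f i))) (Box (modal (g i)))) is))
        (MOr (Box (MNeg (modal \<phi>))) (Box (modal \<psi>))))"
  proof (rule K_choice[OF \<open>distinct is\<close>])
    fix c
    have *: "map (\<lambda>i. if c i then Box (modal (f i)) else Box (modal (g i))) is =
        map (\<lambda>\<chi>. Box (modal \<chi>)) (?L c)"
      by simp
    show "K_provable (MImp (MConj (map (\<lambda>i. if c i then Box (modal (f i)) else Box (modal (g i))) is))
        (MOr (Box (MNeg (modal \<phi>))) (Box (modal \<psi>))))"
      using sem'[of c]
    proof
      assume "\<forall>v. holds v (Conj (?L c)) \<longrightarrow> \<not> holds v \<phi>"
      then have "tautology (Imp (Conj (?L c)) (Neg \<phi>))" by (simp add: tautology_def)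
      from K_provable_mono[OF K_Box_entailment[OF this]] show ?thesis unfolding * by simp
    next
      assume "\<forall>v. holds v (Conj (?L c)) \<longrightarrow> holds v \<psi>"
      then have "tautology (Imp (Conj (?L c)) \<psi>)" by (simp add: tautology_def)
      from K_provable_mono[OF K_Box_entailment[OF this]] show ?thesis unfolding * by simp
    qed
  qed
qed

lemma holds_subst_tuple:
  "holds v (subst_tuple ps \<chi>s \<phi>) =
    holds (\<lambda>a. case map_of (zip ps \<chi>s) a of None \<Rightarrow> v a | Some \<chi> \<Rightarrow> holds v \<chi>) \<phi>"
  unfolding subst_tuple_def holds_subst by (rule holds_cong) (auto split: option.split)

theorem theorem5p11:
  fixes ps rs ss :: "'a list" and \<phi> \<psi> :: "'a fm"
  assumes "distinct (ps @ rs @ ss)"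
    and "atoms \<phi> \<subseteq> set ps \<union> set rs"
    and "atoms \<psi> \<subseteq> set ps \<union> set ss"
    and "tautology (Imp \<phi> \<psi>)"
  shows
    "IPC_provable
       (Imp (Conj (map (\<lambda>p. Or (Atom p) (Neg (Atom p))) ps))
            (Or (Neg \<phi>) (Neg (Neg \<psi>)))) \<and>
     K_provable
       (MImp (MConj (map (\<lambda>p. MOr (Box (MAtom p)) (Box (MNeg (MAtom p)))) ps))
             (MOr (Box (MNeg (modal \<phi>))) (Box (modal \<psi>)))) \<and>
     (monotone_in (set ps) \<phi> \<or> monotone_in (set ps) \<psi> \<longrightarrow>
       (\<forall>qs. length qs = length ps \<and> distinct (ps @ qs @ rs @ ss) \<longrightarrow>
          IPC_provable
            (Imp (Conj (map2 (\<lambda>p q. Or (Atom p) (Atom q)) ps qs))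
                 (Or (Neg (subst_tuple ps (map (\<lambda>p. Neg (Atom p)) ps) \<phi>))
                     (Neg (Neg (subst_tuple ps (map Atom qs) \<psi>))))) \<and>
          K_provable
            (MImp (MConj (map2 (\<lambda>p q. MOr (Box (MAtom p)) (Box (MAtom q))) ps qs))
                  (MOr (Box (MNeg (modal (subst_tuple ps (map (\<lambda>p. Neg (Atom p)) ps) \<phi>))))
                       (Box (modal (subst_tuple ps (map Atom qs) \<psi>)))))))"
proof (intro conjI impI allI)
  \<comment> \<open>The shared atoms all lie in \<open>ps\<close>, where the common literals force
    \<open>v\<close> and \<open>w\<close> to agree.\<close>
  have sem: "holds w \<psi>"
    if "holds v (Conj (map (\<lambda>p. if c p then Atom p else Neg (Atom p)) ps))"
      "holds w (Conj (map (\<lambda>p. if c p then Atom p else Neg (Atom p)) ps))" "holds v \<phi>" for c v w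
  proof (rule tautology_Imp_transfer[where P = "{}", OF assms(4) _ _ _ \<open>holds v \<phi>\<close>])
    fix a assume "a \<in> atoms \<phi> \<inter> atoms \<psi> - {}"
    then have "a \<in> set ps" using assms(1-3) by auto
    then show "v a = w a" using that(1,2) by (cases "c a") (auto simp: holds_Conj_map)
  qed (auto simp: monotone_in_def)
  have "distinct ps" using assms(1) by simp
  show "IPC_provable
       (Imp (Conj (map (\<lambda>p. Or (Atom p) (Neg (Atom p))) ps))
            (Or (Neg \<phi>) (Neg (Neg \<psi>))))"
    by (rule IPC_provable_disjunction[OF \<open>distinct ps\<close>]) (erule (2) sem)
  have "K_provable
       (MImp (MConj (map (\<lambda>p. MOr (Box (modal (Atom p))) (Box (modal (Neg (Atom p))))) ps))
             (MOr (Box (MNeg (modal \<phi>))) (Box (modal \<psi>))))"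
    by (rule K_provable_disjunction[OF \<open>distinct ps\<close>]) (erule (2) sem)
  then show "K_provable
       (MImp (MConj (map (\<lambda>p. MOr (Box (MAtom p)) (Box (MNeg (MAtom p)))) ps))
             (MOr (Box (MNeg (modal \<phi>))) (Box (modal \<psi>))))"
    by simp
next
  fix qs
  assume mono: "monotone_in (set ps) \<phi> \<or> monotone_in (set ps) \<psi>"
    and qs: "length qs = length ps \<and> distinct (ps @ qs @ rs @ ss)"
  let ?\<phi> = "subst_tuple ps (map (\<lambda>p. Neg (Atom p)) ps) \<phi>"
    and ?\<psi> = "subst_tuple ps (map Atom qs) \<psi>"
  \<comment> \<open>The indices of the case distinction are now the pairs (p, q), with the two
    components as alternatives.\<close>
  have "distinct (zip ps qs)" using assms(1) by (simp add: distinct_zipI1)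
  have sem: "holds w ?\<psi>"
    if v: "holds v (Conj (map (\<lambda>i. if c i then Atom (fst i) else Atom (snd i)) (zip ps qs)))"
      and w: "holds w (Conj (map (\<lambda>i. if c i then Atom (fst i) else Atom (snd i)) (zip ps qs)))"
      and "holds v ?\<phi>" for c v w
  proof -
    \<comment> \<open>These are the valuations that \<phi> and \<psi> see after substitution:
      \<open>?v\<close> negates \<open>v\<close> on \<open>ps\<close>, and \<open>?w\<close> reads
      at each p the value of \<open>w\<close> at its partner q.\<close>
    let ?v = "\<lambda>a. case map_of (zip ps (map (\<lambda>p. Neg (Atom p)) ps)) a of
        None \<Rightarrow> v a | Some \<chi> \<Rightarrow> holds v \<chi>"
      and ?w = "\<lambda>a. case map_of (zip ps (map Atom qs)) a of
        None \<Rightarrow> w a | Some \<chi> \<Rightarrow> holds w \<chi>"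
    have "holds ?v \<phi>" using \<open>holds v ?\<phi>\<close> by (simp add: holds_subst_tuple)
    have "holds ?w \<psi>"
    proof (rule tautology_Imp_transfer[OF assms(4) mono _ _ \<open>holds ?v \<phi>\<close>])
      fix a assume "a \<in> atoms \<phi> \<inter> atoms \<psi> - set ps"
      \<comment> \<open>No such atom exists: it would lie in both \<open>rs\<close> and
        \<open>ss\<close>.\<close>
      then show "?v a = ?w a" using assms(1-3) by auto
    next
      fix a assume "a \<in> set ps" and "?v a"
      then have "\<not> v a" by (simp add: zip_map2 zip_same_conv_map o_def map_of_map_restrict)
      obtain q where q: "map_of (zip ps qs) a = Some q"
        using \<open>a \<in> set ps\<close> qs by (metis map_of_zip_is_Some)
      then have "(a, q) \<in> set (zip ps qs)" by (rule map_of_SomeD)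
      \<comment> \<open>The choice at (a, q) cannot be \<open>a\<close>, which \<open>v\<close>
        falsifies; so it is \<open>q\<close>, and \<open>w\<close> obeys the same choice.\<close>
      with v w \<open>\<not> v a\<close> have "w q" by (cases "c (a, q)") (force simp: holds_Conj_map)+
      then show "?w a" using q by (simp add: zip_map2 map_of_map)
    qed
    then show ?thesis using qs by (simp add: holds_subst_tuple)
  qed
  show "IPC_provable
       (Imp (Conj (map2 (\<lambda>p q. Or (Atom p) (Atom q)) ps qs)) (Or (Neg ?\<phi>) (Neg (Neg ?\<psi>))))"
    unfolding case_prod_beta
    by (rule IPC_provable_disjunction[OF \<open>distinct (zip ps qs)\<close>]) (erule (2) sem)
  have "K_provable
       (MImp (MConj (map (\<lambda>i. MOr (Box (modal (Atom (fst i)))) (Box (modal (Atom (snd i)))))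
                      (zip ps qs)))
             (MOr (Box (MNeg (modal ?\<phi>))) (Box (modal ?\<psi>))))"
    by (rule K_provable_disjunction[OF \<open>distinct (zip ps qs)\<close>]) (erule (2) sem)
  then show "K_provable
       (MImp (MConj (map2 (\<lambda>p q. MOr (Box (MAtom p)) (Box (MAtom q))) ps qs))
             (MOr (Box (MNeg (modal ?\<phi>))) (Box (modal ?\<psi>))))"
    unfolding case_prod_beta by simp
qed

end
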